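(* For every integer $k\geq 1$, the graph $DDPG_{k,2}$ is an extremal graph having a set of $k$ totally disjoint diametral paths of length $2$; that is, it has such a set, and its number of edges is the minimum possible among all graphs having $k$ totally disjoint diametral paths of length $2$.
   Context: All graphs are finite, simple and connected. The length of a path is its number of edges. The diameter of $G$ is the greatest distance between any pair of vertices; a diametral path is a shortest path connecting two vertices whose distance equals the diameter (so having a diametral path of length $d$ means the diameter is $d$). Two paths are totally disjoint if they have no vertex in common, including their end vertices; a set of paths is totally disjoint if every two of its members are. $MinE(k,d)$ denotes the minimum number of edges in a graph having $k$ totally disjoint diametral paths of length $d$; a graph having $k$ totally disjoint diametral paths of length $d$ and exactly $MinE(k,d)$ edges is called extremal. $DDPG_{k,2}$ consists of $k$ vertex-disjoint paths $p_1,\dots,p_k$ of length $2$, where $p_i$ has vertices $p_{i,0},p_{i,1},p_{i,2}$ connected by edges in that order, together with edges joining the middle vertex $p_{1,1}$ of $p_1$ to all three vertices of every other path $p_i$, $1<i\le k$. *)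

theory Defs
  imports Main
begin

record 'v graph =
  verts :: "'v set"
  edges :: "'v set set"

definition is_path :: "'v graph \<Rightarrow> 'v list \<Rightarrow> bool" where
  "is_path G p \<longleftrightarrow> p \<noteq> [] \<and> distinct p \<and> set p \<subseteq> verts G \<and>
     (\<forall>i. Suc i < length p \<longrightarrow> {p ! i, p ! Suc i} \<in> edges G)"

definition path_length :: "'v list \<Rightarrow> nat" where
  "path_length p = length p - 1"

definition path_between :: "'v graph \<Rightarrow> 'v \<Rightarrow> 'v \<Rightarrow> 'v list \<Rightarrow> bool" where
  "path_between G u v p \<longleftrightarrow> is_path G p \<and> hd p = u \<and> last p = v"

definition finite_simple_connected :: "'v graph \<Rightarrow> bool" where
  "finite_simple_connected G \<longleftrightarrow>
     finite (verts G) \<and> verts G \<noteq> {} \<and>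
     (\<forall>e \<in> edges G. e \<subseteq> verts G \<and> card e = 2) \<and>
     (\<forall>u \<in> verts G. \<forall>v \<in> verts G. \<exists>p. path_between G u v p)"

definition distance :: "'v graph \<Rightarrow> 'v \<Rightarrow> 'v \<Rightarrow> nat" where
  "distance G u v = (LEAST n. \<exists>p. path_between G u v p \<and> path_length p = n)"

definition diameter :: "'v graph \<Rightarrow> nat" where
  "diameter G = Max {distance G u v | u v. u \<in> verts G \<and> v \<in> verts G}"

definition shortest_path :: "'v graph \<Rightarrow> 'v list \<Rightarrow> bool" where
  "shortest_path G p \<longleftrightarrow> is_path G p \<and> path_length p = distance G (hd p) (last p)"

definition diametral_path :: "'v graph \<Rightarrow> 'v list \<Rightarrow> bool" where
  "diametral_path G p \<longleftrightarrow> shortest_path G p \<and> distance G (hd p) (last p) = diameter G"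

definition totally_disjoint :: "'v list set \<Rightarrow> bool" where
  "totally_disjoint P \<longleftrightarrow> (\<forall>p \<in> P. \<forall>q \<in> P. p \<noteq> q \<longrightarrow> set p \<inter> set q = {})"

text \<open>A path and its reversal are different lists, but they share their vertices, so a totally
  disjoint set contains at most one of them and its cardinality counts undirected paths.\<close>

definition has_disjoint_diametral_paths :: "nat \<Rightarrow> nat \<Rightarrow> 'v graph \<Rightarrow> bool" where
  "has_disjoint_diametral_paths k d G \<longleftrightarrow>
     (\<exists>P. finite P \<and> card P = k \<and> totally_disjoint P \<and>
          (\<forall>p \<in> P. diametral_path G p \<and> path_length p = d))"

text \<open>Every finite graph is isomorphic to one whose vertices are natural numbers, so the minimum
  over graphs of type \<^typ>\<open>nat graph\<close> is the minimum over all graphs; see lemma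
  \<open>MinE_le\<close> below.\<close>

definition MinE :: "nat \<Rightarrow> nat \<Rightarrow> nat" where
  "MinE k d = (LEAST m. \<exists>G :: nat graph. finite_simple_connected G \<and>
     has_disjoint_diametral_paths k d G \<and> card (edges G) = m)"

definition extremal :: "nat \<Rightarrow> nat \<Rightarrow> 'v graph \<Rightarrow> bool" where
  "extremal k d G \<longleftrightarrow> finite_simple_connected G \<and>
     has_disjoint_diametral_paths k d G \<and> card (edges G) = MinE k d"

text \<open>The pair \<open>(i, j)\<close> is the vertex \<open>p\<^sub>i\<^sub>,\<^sub>j\<close>.\<close>

definition DDPG2 :: "nat \<Rightarrow> (nat \<times> nat) graph" where
  "DDPG2 k = \<lparr>
     verts = {1..k} \<times> {0..2},
     edges = {{(i, j), (i, Suc j)} | i j. i \<in> {1..k} \<and> j < 2} \<union>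
             {{(1, 1), (i, j)} | i j. 1 < i \<and> i \<le> k \<and> j \<le> 2} \<rparr>"

definition image_graph :: "('v \<Rightarrow> 'w) \<Rightarrow> 'v graph \<Rightarrow> 'w graph" where
  "image_graph f G = \<lparr> verts = f ` verts G, edges = (`) f ` edges G \<rparr>"

lemma is_path_image_graph:
  assumes inj: "inj_on f (verts G)" and sub: "\<forall>e \<in> edges G. e \<subseteq> verts G"
    and p: "set p \<subseteq> verts G"
  shows "is_path (image_graph f G) (map f p) \<longleftrightarrow> is_path G p"
proof -
  have "{f (p ! i), f (p ! Suc i)} \<in> (`) f ` edges G \<longleftrightarrow> {p ! i, p ! Suc i} \<in> edges G"
    if "Suc i < length p" for i
  proof -
    have "{p ! i, p ! Suc i} \<subseteq> verts G"
      using that p by (auto dest: nth_mem)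
    then have "f ` {p ! i, p ! Suc i} = f ` e \<longleftrightarrow> {p ! i, p ! Suc i} = e" if "e \<in> edges G" for e
      using inj_on_image_eq_iff[OF inj] sub that by blast
    then show ?thesis
      by (auto simp: image_iff)
  qed
  moreover have "distinct (map f p) \<longleftrightarrow> distinct p"
    using inj p by (auto simp: distinct_map intro: inj_on_subset)
  ultimately show ?thesis
    using p by (auto simp: is_path_def image_graph_def)
qed

lemma path_between_image_graph:
  assumes inj: "inj_on f (verts G)" and sub: "\<forall>e \<in> edges G. e \<subseteq> verts G"
    and uv: "u \<in> verts G" "v \<in> verts G"
  shows "path_between (image_graph f G) (f u) (f v) q \<longleftrightarrow>
    (\<exists>p. path_between G u v p \<and> q = map f p)"
proof
  assume q: "path_between (image_graph f G) (f u) (f v) q"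
  then have "set q \<subseteq> f ` verts G"
    by (auto simp: path_between_def is_path_def image_graph_def)
  then have "q \<in> map f ` lists (verts G)"
    by (simp add: lists_image[symmetric] in_lists_conv_set subset_iff)
  then obtain p where p: "set p \<subseteq> verts G" "q = map f p"
    by auto
  have P: "is_path G p"
    using q p is_path_image_graph[OF inj sub p(1)] by (simp add: path_between_def)
  then have ne: "p \<noteq> []"
    by (simp add: is_path_def)
  have "f (hd p) = f u" "f (last p) = f v"
    using q p ne by (auto simp: path_between_def hd_map last_map)
  moreover have "hd p \<in> verts G" "last p \<in> verts G"
    using p ne by auto
  ultimately have "hd p = u" "last p = v"
    using inj uv by (auto dest: inj_onD)
  then show "\<exists>p. path_between G u v p \<and> q = map f p"
    using P p by (auto simp: path_between_def)
next
  assume "\<exists>p. path_between G u v p \<and> q = map f p"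
  then obtain p where p: "path_between G u v p" "q = map f p"
    by blast
  moreover have "set p \<subseteq> verts G" "p \<noteq> []"
    using p by (auto simp: path_between_def is_path_def)
  ultimately show "path_between (image_graph f G) (f u) (f v) q"
    using is_path_image_graph[OF inj sub] by (auto simp: path_between_def hd_map last_map)
qed

lemma distance_image_graph:
  assumes "inj_on f (verts G)" "\<forall>e \<in> edges G. e \<subseteq> verts G" "u \<in> verts G" "v \<in> verts G"
  shows "distance (image_graph f G) (f u) (f v) = distance G u v"
proof -
  have "(\<exists>q. path_between (image_graph f G) (f u) (f v) q \<and> path_length q = n) \<longleftrightarrow>
    (\<exists>p. path_between G u v p \<and> path_length p = n)" for n
    unfolding path_between_image_graph[OF assms] by (auto simp: path_length_def)
  then show ?thesis
    by (simp add: distance_def)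
qed

lemma diameter_image_graph:
  assumes "inj_on f (verts G)" "\<forall>e \<in> edges G. e \<subseteq> verts G"
  shows "diameter (image_graph f G) = diameter G"
proof -
  have "{distance (image_graph f G) u v | u v.
      u \<in> verts (image_graph f G) \<and> v \<in> verts (image_graph f G)} =
    {distance (image_graph f G) (f u) (f v) | u v. u \<in> verts G \<and> v \<in> verts G}"
    by (auto simp: image_graph_def)
  also have "\<dots> = {distance G u v | u v. u \<in> verts G \<and> v \<in> verts G}"
    by (intro Collect_cong ex_cong1) (auto simp: distance_image_graph[OF assms])
  finally show ?thesis
    by (simp add: diameter_def)
qed

lemma diametral_path_image_graph:
  assumes "inj_on f (verts G)" "\<forall>e \<in> edges G. e \<subseteq> verts G" "diametral_path G p"
  shows "diametral_path (image_graph f G) (map f p)"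
proof -
  have p: "is_path G p" "set p \<subseteq> verts G" "p \<noteq> []"
    using assms(3) by (auto simp: diametral_path_def shortest_path_def is_path_def)
  then have "hd p \<in> verts G" "last p \<in> verts G"
    by auto
  then show ?thesis
    using p assms is_path_image_graph[OF assms(1,2) p(2)] distance_image_graph[OF assms(1,2)]
      diameter_image_graph[OF assms(1,2)]
    by (simp add: diametral_path_def shortest_path_def path_length_def hd_map last_map)
qed

lemma has_disjoint_diametral_paths_image_graph:
  assumes inj: "inj_on f (verts G)" and sub: "\<forall>e \<in> edges G. e \<subseteq> verts G"
    and "has_disjoint_diametral_paths k d G"
  shows "has_disjoint_diametral_paths k d (image_graph f G)"
proof -
  obtain P where P: "finite P" "card P = k" "totally_disjoint P"
    "\<forall>p \<in> P. diametral_path G p \<and> path_length p = d"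
    using assms(3) by (auto simp: has_disjoint_diametral_paths_def)
  have V: "set p \<subseteq> verts G" if "p \<in> P" for p
    using P that by (auto simp: diametral_path_def shortest_path_def is_path_def)
  have "inj_on (map f) P"
    by (rule inj_on_mapI, rule inj_on_subset[OF inj]) (use V in auto)
  then have "card (map f ` P) = k"
    using P by (simp add: card_image)
  moreover have "totally_disjoint (map f ` P)"
    unfolding totally_disjoint_def
  proof (intro ballI impI)
    fix x y assume "x \<in> map f ` P" "y \<in> map f ` P" "x \<noteq> y"
    then obtain p q where pq: "p \<in> P" "q \<in> P" "p \<noteq> q" "x = map f p" "y = map f q"
      by auto
    then have "set p \<inter> set q = {}"
      using P by (auto simp: totally_disjoint_def)
    then show "set x \<inter> set y = {}"
      using inj_on_image_Int[OF inj V[OF pq(1)] V[OF pq(2)]] pq by simp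
  qed
  moreover have "\<forall>p \<in> map f ` P. diametral_path (image_graph f G) p \<and> path_length p = d"
    using P diametral_path_image_graph[OF inj sub] by (auto simp: path_length_def)
  ultimately show ?thesis
    using P(1) unfolding has_disjoint_diametral_paths_def by blast
qed

lemma finite_simple_connected_image_graph:
  assumes inj: "inj_on f (verts G)" and G: "finite_simple_connected G"
  shows "finite_simple_connected (image_graph f G)"
proof -
  have sub: "\<forall>e \<in> edges G. e \<subseteq> verts G"
    using G by (simp add: finite_simple_connected_def)
  have "\<exists>q. path_between (image_graph f G) (f u) (f v) q" if "u \<in> verts G" "v \<in> verts G" for u v
    using G that path_between_image_graph[OF inj sub that]
    by (auto simp: finite_simple_connected_def)
  moreover have "card (f ` e) = 2" if "e \<in> edges G" for e
    using G that inj_on_subset[OF inj]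
    by (auto simp: finite_simple_connected_def card_image)
  moreover have "f ` e \<subseteq> f ` verts G" if "e \<in> edges G" for e
    using sub that by blast
  ultimately show ?thesis
    using G by (simp add: finite_simple_connected_def image_graph_def)
qed

lemma MinE_le:
  fixes G :: "'v graph"
  assumes G: "finite_simple_connected G" and "has_disjoint_diametral_paths k d G"
  shows "MinE k d \<le> card (edges G)"
proof -
  obtain f :: "'v \<Rightarrow> nat" where inj: "inj_on f (verts G)"
    using G finite_imp_inj_to_nat_seg by (metis finite_simple_connected_def)
  have sub: "\<forall>e \<in> edges G. e \<subseteq> verts G"
    using G by (simp add: finite_simple_connected_def)
  have "inj_on ((`) f) (edges G)"
    using inj sub by (meson inj_onI inj_on_image_eq_iff)
  then have "card (edges (image_graph f G)) = card (edges G)"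
    by (simp add: image_graph_def card_image)
  then show ?thesis
    unfolding MinE_def
    using finite_simple_connected_image_graph[OF inj G]
      has_disjoint_diametral_paths_image_graph[OF inj sub assms(2)]
    by (intro Least_le) blast
qed

end

theory Submission
  imports Defs
begin

text \<open>The lower bound is \<open>5 k - 3\<close> edges. Let \<open>G\<close> have diameter \<open>2\<close>, \<open>n\<close> vertices and \<open>k\<close> disjoint
  diametral paths, so that \<open>n \<ge> 3 k\<close>. If some vertex is adjacent to all others, its \<open>n - 1\<close> edges
  and the \<open>2 (k - 1)\<close> edges of the paths avoiding it suffice. Otherwise, by a theorem of
  Erdos and Renyi, \<open>G\<close> has at least \<open>2 n - 5\<close> edges, which is enough for \<open>k \<ge> 2\<close>. To see
  this, let \<open>v\<close> have minimum degree \<open>\<delta>\<close>. The degrees of the neighbours of \<open>v\<close> sum to at least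
  \<open>n - 1\<close>, which settles \<open>\<delta> = 3\<close> by the handshake lemma; \<open>\<delta> \<ge> 4\<close> is immediate and \<open>\<delta> = 1\<close>
  would give a dominating vertex. If \<open>v\<close> has exactly the neighbours \<open>a\<close> and \<open>b\<close>, every other vertex
  is adjacent to \<open>a\<close> or \<open>b\<close>, and those adjacent to only one of them
  need about as many further edges, because they lie in one component of \<open>G - {a, b}\<close> or are each
  joined to a common neighbour of \<open>a\<close> and \<open>b\<close>.\<close>

section \<open>Counting edges by choosing a parent for each vertex\<close>

definition nbhd :: "'v set set \<Rightarrow> 'v \<Rightarrow> 'v set" where
  "nbhd E v = {w. {v, w} \<in> E}"

lemma nbhd_commute: "w \<in> nbhd E v \<longleftrightarrow> v \<in> nbhd E w"
  by (simp add: nbhd_def insert_commute)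

text \<open>Mapping \<open>u\<close> to the edge \<open>{u, f u}\<close> is injective on
  \<open>S\<close>: two vertices with the same edge would be each other's parent, and
  \<open>rank\<close> would decrease in both directions.\<close>

lemma card_le_edges_parent:
  fixes rank :: "'v \<Rightarrow> nat"
  assumes "finite E" and "\<And>u. u \<in> S \<Longrightarrow> {u, f u} \<in> E \<and> rank (f u) < rank u"
  shows "card S \<le> card E"
proof (rule card_inj_on_le)
  show "inj_on (\<lambda>u. {u, f u}) S"
  proof (rule inj_onI)
    fix u w assume uw: "u \<in> S" "w \<in> S" "{u, f u} = {w, f w}"
    show "u = w"
    proof (rule ccontr)
      assume "u \<noteq> w"
      then have "u = f w" "w = f u"
        using uw(3) by (auto simp: doubleton_eq_iff)
      then show False
        using assms(2)[OF uw(1)] assms(2)[OF uw(2)] by simp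
    qed
  qed
qed (use assms in auto)

text \<open>Breadth-first tree argument: every vertex of \<open>S\<close> other than the root
  \<open>r\<close> chooses a neighbour strictly closer to \<open>r\<close>, and \<open>Suc\<close>
  pays for the root.\<close>

lemma card_le_edges_reachable:
  assumes "finite E" "finite S" and reach: "\<And>u. u \<in> S \<Longrightarrow> (r, u) \<in> {(x, y). {x, y} \<in> E}\<^sup>*"
  shows "card S \<le> Suc (card E)"
proof -
  define T where "T = {(x, y). {x, y} \<in> E}"
  \<comment> \<open>Distance from \<open>r\<close> along edges of \<open>E\<close>, meaningful at
    the vertices reachable from \<open>r\<close>.\<close>
  define rank where "rank u = (LEAST n. (r, u) \<in> T ^^ n)" for u
  have "\<exists>w. {u, w} \<in> E \<and> rank w < rank u" if u: "u \<in> S - {r}" for u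
  proof -
    have "\<exists>n. (r, u) \<in> T ^^ n"
      using reach[of u] u by (auto simp: T_def rtrancl_power)
    then have n: "(r, u) \<in> T ^^ rank u"
      unfolding rank_def by (rule LeastI_ex)
    moreover have "rank u \<noteq> 0"
      using n u by (cases "rank u") auto
    then obtain m where m: "rank u = Suc m"
      using not0_implies_Suc by blast
    ultimately obtain w where w: "(r, w) \<in> T ^^ m" "(w, u) \<in> T"
      by auto
    have "rank w \<le> m"
      unfolding rank_def using w(1) by (rule Least_le)
    then show ?thesis
      using w m by (auto simp: T_def insert_commute)
  qed
  then obtain f where "\<And>u. u \<in> S - {r} \<Longrightarrow> {u, f u} \<in> E \<and> rank (f u) < rank u"
    by metis
  then have "card (S - {r}) \<le> card E"
    using card_le_edges_parent[OF assms(1)] by blast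
  then show ?thesis
    using card_Diff1_le[of S r] card_Diff_singleton[of r S]
    by (cases "r \<in> S") auto
qed

section \<open>Graphs of diameter at most two\<close>

text \<open>Diameter at most two is expressed by common neighbours alone, so that the counting
  proceeds without paths or distances.\<close>

locale graph_diam2 =
  fixes V :: "'v set" and E :: "'v set set"
  assumes finV: "finite V"
    and edge: "e \<in> E \<Longrightarrow> e \<subseteq> V \<and> card e = 2"
    and diam2: "\<lbrakk>u \<in> V; v \<in> V; u \<noteq> v; {u, v} \<notin> E\<rbrakk> \<Longrightarrow> \<exists>w. {u, w} \<in> E \<and> {w, v} \<in> E"
begin

lemma finE: "finite E"
  using finV edge by (meson PowI finite_Pow_iff finite_subset subsetI)

lemma edgeD: "{u, w} \<in> E \<Longrightarrow> u \<in> V \<and> w \<in> V \<and> u \<noteq> w"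
  using edge[of "{u, w}"] by (cases "u = w") auto

lemma nbhd_subset: "nbhd E v \<subseteq> V - {v}"
  using edgeD by (auto simp: nbhd_def)

lemma finite_nbhd [simp]: "finite (nbhd E v)"
  using nbhd_subset finV by (meson finite_Diff finite_subset)

lemma card_nbhd: "card (nbhd E v) = card {e \<in> E. v \<in> e}"
proof -
  have "inj_on (\<lambda>w. {v, w}) (nbhd E v)"
    by (auto simp: inj_on_def doubleton_eq_iff)
  moreover have "(\<lambda>w. {v, w}) ` nbhd E v = {e \<in> E. v \<in> e}"
  proof (intro subset_antisym subsetI)
    fix e assume e: "e \<in> {e \<in> E. v \<in> e}"
    then obtain x y where "e = {x, y}"
      using edge by (metis (no_types, lifting) card_2_iff mem_Collect_eq)
    then show "e \<in> (\<lambda>w. {v, w}) ` nbhd E v"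
      using e by (auto simp: nbhd_def insert_commute)
  qed (auto simp: nbhd_def)
  ultimately show ?thesis
    by (metis card_image)
qed

lemma handshake: "(\<Sum>v\<in>V. card (nbhd E v)) = 2 * card E"
proof -
  \<comment> \<open>Both sides count the incident pairs of a vertex and an edge.\<close>
  have "(\<Sum>v\<in>V. card {e \<in> E. v \<in> e}) = (\<Sum>e\<in>E. card {v \<in> V. v \<in> e})"
    using sum.swap_restrict[OF finV finE, of "\<lambda>_ _. 1 :: nat" "\<lambda>v e. v \<in> e"] by simp
  also have "\<dots> = (\<Sum>e\<in>E. 2)"
  proof (rule sum.cong)
    fix e assume "e \<in> E"
    then have "{v \<in> V. v \<in> e} = e" "card e = 2"
      using edge by auto
    then show "card {v \<in> V. v \<in> e} = 2"
      by simp
  qed simp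
  finally show ?thesis
    by (simp add: card_nbhd)
qed

text \<open>Every vertex outside the closed neighbourhood of \<open>v\<close> is adjacent to some
  neighbour of \<open>v\<close>. Moreover \<open>v\<close> itself occurs once in each
  \<open>nbhd E a\<close>, which contributes the remaining \<open>card (nbhd E v)\<close>.\<close>

lemma sum_card_nbhd_nbhd:
  assumes v: "v \<in> V"
  shows "card V - 1 \<le> (\<Sum>a\<in>nbhd E v. card (nbhd E a))"
proof -
  let ?N = "nbhd E v"
  have "V - {v} - ?N \<subseteq> (\<Union>a\<in>?N. nbhd E a - {v})"
    using diam2[OF v] by (fastforce simp: nbhd_def)
  then have "card (V - {v} - ?N) \<le> card (\<Union>a\<in>?N. nbhd E a - {v})"
    by (intro card_mono) auto
  also have "\<dots> \<le> (\<Sum>a\<in>?N. card (nbhd E a - {v}))"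
    by (rule card_UN_le) simp
  finally have "card (V - {v} - ?N) + card ?N \<le> (\<Sum>a\<in>?N. card (nbhd E a - {v}) + 1)"
    by (simp add: sum_Suc)
  also have "\<dots> = (\<Sum>a\<in>?N. card (nbhd E a))"
  proof (rule sum.cong)
    fix a assume "a \<in> ?N"
    then have "v \<in> nbhd E a"
      by (simp add: nbhd_commute)
    then show "card (nbhd E a - {v}) + 1 = card (nbhd E a)"
      by (metis Suc_eq_plus1 card.remove finite_nbhd)
  qed simp
  finally show ?thesis
    using nbhd_subset[of v] v finV card_mono[OF _ nbhd_subset[of v]]
    by (simp add: card_Diff_subset)
qed

section \<open>Minimum degree two\<close>

text \<open>The vertices counted on the left are the private neighbours, adjacent to exactly one of
  \<open>a\<close> and \<open>b\<close>. If both \<open>a\<close> and \<open>b\<close> have some,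
  the edges avoiding \<open>a\<close> and \<open>b\<close> connect all of them. If only one has
  some, each is joined by its own such edge to a common neighbour of \<open>a\<close> and
  \<open>b\<close>.\<close>

lemma card_private_nbhd:
  assumes v: "v \<in> V" "nbhd E v = {a, b}" "a \<noteq> b"
    and nodom: "\<And>u. u \<in> V \<Longrightarrow> nbhd E u \<noteq> V - {u}"
    and X: "X = nbhd E a - {b}" and Y: "Y = nbhd E b - {a}"
  shows "card ((X - Y) \<union> (Y - X)) \<le> Suc (card {e \<in> E. a \<notin> e \<and> b \<notin> e})"
proof -
  define F where "F = {e \<in> E. a \<notin> e \<and> b \<notin> e}"
  have finF: "finite F"
    using finE by (simp add: F_def)
  have ab: "{v, a} \<in> E" "{v, b} \<in> E"
    using v by (auto simp: nbhd_def)
  have abV: "a \<in> V" "b \<in> V"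
    using ab edgeD by blast+
  have only: "w = a \<or> w = b" if "{v, w} \<in> E" for w
    using v(2) that by (auto simp: nbhd_def)
  \<comment> \<open>The case where \<open>p\<close> has no private neighbours, stated for
    \<open>a\<close> and \<open>b\<close> in either order so that it serves both one-sided
    cases.\<close>
  have empty: "card B \<le> card F"
    if *: "B = Q - P" "P - Q = {}" "P = nbhd E p - {q}" "Q = nbhd E q - {p}"
      "{a, b} = {p, q}" "p \<noteq> q" for B P Q p q
  proof -
    have pq: "p \<in> V" "q \<in> V" "{v, p} \<in> E" "{v, q} \<in> E"
      using abV ab *(5) by (auto simp: doubleton_eq_iff)
    have cover: "u \<in> P \<union> Q" if u: "u \<in> V" "u \<noteq> p" "u \<noteq> q" for u
    proof (cases "u = v")
      case True
      then show ?thesis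
        using pq u *(3) by (auto simp: nbhd_def insert_commute)
    next
      case False
      moreover have "{v, u} \<notin> E"
        using only[of u] u *(5) by (auto simp: doubleton_eq_iff)
      ultimately obtain w where w: "{v, w} \<in> E" "{w, u} \<in> E"
        using diam2[OF v(1) u(1)] by blast
      then have "w = p \<or> w = q"
        using only[of w] *(5) by (auto simp: doubleton_eq_iff)
      then show ?thesis
        using w u *(3,4) by (auto simp: nbhd_def)
    qed
    \<comment> \<open>If \<open>p\<close> and \<open>q\<close> were adjacent, \<open>q\<close> would
      dominate: \<open>P\<close> lies inside \<open>Q\<close>, and together they cover all other
      vertices.\<close>
    have npq: "{p, q} \<notin> E"
    proof
      assume pqE: "{p, q} \<in> E"
      have "V - {q} \<subseteq> nbhd E q"
      proof
        fix u assume u: "u \<in> V - {q}"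
        show "u \<in> nbhd E q"
        proof (cases "u = p")
          case True
          then show ?thesis using pqE by (simp add: nbhd_def insert_commute)
        next
          case False
          then have "u \<in> Q" using cover[of u] u *(2) by blast
          then show ?thesis using *(4) by simp
        qed
      qed
      then show False
        using nodom[OF pq(2)] nbhd_subset[of q] by blast
    qed
    \<comment> \<open>The witness is a common neighbour of \<open>y\<close> and \<open>p\<close>. It
      differs from \<open>q\<close> because \<open>p\<close> and \<open>q\<close> are not adjacent,
      and it lies in \<open>P\<close>, hence outside \<open>B\<close>.\<close>
    have "\<exists>c. {y, c} \<in> F \<and> c \<notin> B" if y: "y \<in> B" for y
    proof -
      have yq: "{q, y} \<in> E" "y \<noteq> p" "{p, y} \<notin> E"
        using y *(1,3,4) edgeD by (auto simp: nbhd_def)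
      then obtain c where c: "{y, c} \<in> E" "{c, p} \<in> E"
        using diam2[of y p] pq edgeD by (metis insert_commute)
      have "c \<noteq> p" "c \<noteq> q" "y \<noteq> q"
        using c npq edgeD yq by (auto simp: insert_commute)
      moreover from this have "c \<in> P"
        using c *(3) by (auto simp: nbhd_def insert_commute)
      moreover have "a \<in> {p, q}" "b \<in> {p, q}"
        using *(5) by auto
      ultimately show ?thesis
        using c yq *(1) by (auto simp: F_def)
    qed
    then obtain f where "\<And>y. y \<in> B \<Longrightarrow> {y, f y} \<in> F \<and> f y \<notin> B"
      by metis
    \<comment> \<open>The rank drops from 1 to 0 because \<open>f\<close> leads out of
      \<open>B\<close>.\<close>
    then show ?thesis
      using card_le_edges_parent[OF finF, of B f "\<lambda>u. if u \<in> B then 1 else 0"] by auto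
  qed
  consider "X - Y = {}" | "Y - X = {}" | "X - Y \<noteq> {}" "Y - X \<noteq> {}"
    by blast
  then show ?thesis
  proof cases
    case 1
    then show ?thesis
      using empty[OF refl 1 X Y refl v(3)] unfolding F_def 1 by simp
  next
    case 2
    then show ?thesis
      using empty[OF refl 2 Y X _ v(3)[symmetric]] unfolding F_def 2 by (simp add: insert_commute)
  next
    case 3
    define T where "T = {(x, y). {x, y} \<in> F}"
    have sym: "(x, y) \<in> T\<^sup>* \<Longrightarrow> (y, x) \<in> T\<^sup>*" for x y
      by (rule symD[OF sym_rtrancl]) (auto simp: T_def sym_def insert_commute)
    have link: "(x, y) \<in> T\<^sup>*" if x: "x \<in> X - Y" and y: "y \<in> Y - X" for x y
    proof -
      have xy: "{a, x} \<in> E" "{b, y} \<in> E" "{b, x} \<notin> E" "{a, y} \<notin> E" "x \<noteq> y"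
          "x \<noteq> a" "x \<noteq> b" "y \<noteq> a" "y \<noteq> b" "x \<in> V" "y \<in> V"
        using x y X Y edgeD by (auto simp: nbhd_def)
      show ?thesis
      proof (cases "{x, y} \<in> E")
        case True
        then have "(x, y) \<in> T" using xy by (auto simp: T_def F_def)
        then show ?thesis by blast
      next
        case False
        then obtain w where w: "{x, w} \<in> E" "{w, y} \<in> E"
          using diam2 xy by blast
        \<comment> \<open>\<open>y\<close> is not adjacent to \<open>a\<close>, and \<open>x\<close>
          is not adjacent to \<open>b\<close>.\<close>
        then have "w \<noteq> a" "w \<noteq> b"
          using xy by (auto simp: insert_commute)
        then have "(x, w) \<in> T" "(w, y) \<in> T" using w xy by (auto simp: T_def F_def)
        then show ?thesis by (meson r_into_rtrancl rtrancl_trans)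
      qed
    qed
    obtain x0 y0 where x0: "x0 \<in> X - Y" and y0: "y0 \<in> Y - X"
      using 3 by blast
    \<comment> \<open>The other vertices of \<open>X - Y\<close> are reached from \<open>x0\<close>
      through \<open>y0\<close>.\<close>
    have "(x0, u) \<in> T\<^sup>*" if "u \<in> (X - Y) \<union> (Y - X)" for u
      using that link[OF x0] sym[OF link[OF _ y0]] link[OF x0 y0] rtrancl_trans by (metis UnE)
    moreover have "finite ((X - Y) \<union> (Y - X))"
      using X Y by simp
    ultimately show ?thesis
      using card_le_edges_reachable[OF finF] unfolding T_def F_def by blast
  qed
qed

text \<open>Since \<open>X\<close> and \<open>Y\<close> cover all vertices but \<open>a\<close> and
  \<open>b\<close>, and \<open>F\<close> nearly makes up for the symmetric difference,
  \<open>card X + card Y + card F\<close> is at least \<open>2 * card (X \<union> Y) - 1\<close>,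
  hence at least \<open>2 * card V - 5\<close>.\<close>

lemma card_edges_degree_two:
  assumes v: "v \<in> V" "nbhd E v = {a, b}" "a \<noteq> b"
    and nodom: "\<And>u. u \<in> V \<Longrightarrow> nbhd E u \<noteq> V - {u}"
  shows "2 * card V \<le> card E + 5"
proof -
  define X where "X = nbhd E a - {b}"
  define Y where "Y = nbhd E b - {a}"
  define F where "F = {e \<in> E. a \<notin> e \<and> b \<notin> e}"
  have fin: "finite X" "finite Y" "finite F"
    using finE by (auto simp: X_def Y_def F_def)
  have abV: "a \<in> V" "b \<in> V"
    using v(2) nbhd_subset[of v] by auto
  have "V - {a, b} \<subseteq> X \<union> Y"
  proof
    fix u assume u: "u \<in> V - {a, b}"
    show "u \<in> X \<union> Y"
    proof (cases "u = v")
      case True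
      have "a \<in> nbhd E v" using v by simp
      then show ?thesis using True u by (auto simp: X_def nbhd_commute)
    next
      case False
      have "u \<notin> nbhd E v" using v u by simp
      then have "\<exists>w. {v, w} \<in> E \<and> {w, u} \<in> E"
        using diam2[of v u] v u False by (auto simp: nbhd_def)
      then obtain w where w: "w \<in> nbhd E v" "u \<in> nbhd E w"
        by (auto simp: nbhd_def)
      then show ?thesis using v u by (auto simp: X_def Y_def)
    qed
  qed
  then have "card (V - {a, b}) \<le> card (X \<union> Y)"
    using fin by (intro card_mono) auto
  moreover have "card {a, b} \<le> card V"
    using abV by (intro card_mono[OF finV]) simp
  moreover have "card (V - {a, b}) = card V - 2"
    using abV finV v(3) by (simp add: card_Diff_subset)
  ultimately have n: "card V \<le> card (X \<union> Y) + 2"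
    by linarith
  have "card ((X - Y) \<union> (Y - X)) + card (X \<inter> Y) = card (((X - Y) \<union> (Y - X)) \<union> (X \<inter> Y))"
    using fin by (intro card_Un_disjoint[symmetric]) auto
  also have "((X - Y) \<union> (Y - X)) \<union> (X \<inter> Y) = X \<union> Y"
    by blast
  finally have sym_diff: "card (X \<union> Y) \<le> card F + 1 + card (X \<inter> Y)"
    using card_private_nbhd[OF v nodom X_def Y_def] by (simp add: F_def)
  \<comment> \<open>As \<open>X\<close> omits \<open>b\<close> and \<open>Y\<close> omits
    \<open>a\<close>, the two families of edges are disjoint; a possible edge between
    \<open>a\<close> and \<open>b\<close> is in neither.\<close>
  define FX where "FX = (\<lambda>x. {a, x}) ` X"
  define FY where "FY = (\<lambda>x. {b, x}) ` Y"
  have cX: "card FX = card X" "card FY = card Y"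
    unfolding FX_def FY_def by (auto intro!: card_image simp: inj_on_def doubleton_eq_iff)
  have "card FX + card FY + card F = card (FX \<union> FY \<union> F)"
  proof -
    have "FX \<inter> FY = {}"
      using v(3) by (auto simp: FX_def FY_def X_def Y_def doubleton_eq_iff)
    moreover have "(FX \<union> FY) \<inter> F = {}"
      by (auto simp: FX_def FY_def F_def)
    ultimately show ?thesis
      using fin by (simp add: card_Un_disjoint FX_def FY_def)
  qed
  also have "\<dots> \<le> card E"
    by (rule card_mono[OF finE]) (auto simp: FX_def FY_def F_def X_def Y_def nbhd_def)
  finally have "card X + card Y + card F \<le> card E"
    using cX by simp
  then show ?thesis
    using n sym_diff card_Un_Int[OF fin(1,2)] by linarith
qed

section \<open>Edge bound without a dominating vertex\<close>

theorem card_edges_no_dominating: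
  assumes "2 \<le> card V" and nodom: "\<And>u. u \<in> V \<Longrightarrow> nbhd E u \<noteq> V - {u}"
  shows "2 * card V \<le> card E + 5"
proof -
  have "V \<noteq> {}"
    using assms by auto
  then obtain v where v: "v \<in> V" and min: "\<And>u. u \<in> V \<Longrightarrow> card (nbhd E v) \<le> card (nbhd E u)"
    using ex_min_if_finite[of "(\<lambda>v. card (nbhd E v)) ` V"] finV
    by (metis (no_types, lifting) arg_min_if_finite(1) arg_min_least)
  let ?N = "nbhd E v"
  consider "card ?N = 0" | "card ?N = 1" | "card ?N = 2" | "card ?N = 3" | "4 \<le> card ?N"
    by linarith
  then show ?thesis
  proof cases
    case 1
    then have N: "?N = {}" by simp
    have "V \<noteq> {v}" using assms(1) by auto
    then obtain u where "u \<in> V" "u \<noteq> v" using v by blast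
    then show ?thesis
      using diam2[OF v, of u] N by (auto simp: nbhd_def)
  next
    case 2
    then obtain a where a: "?N = {a}" by (auto simp: card_1_singleton_iff)
    \<comment> \<open>Every walk of two edges from \<open>v\<close> passes through its only
      neighbour \<open>a\<close>.\<close>
    have "V - {a} \<subseteq> nbhd E a"
    proof
      fix u assume u: "u \<in> V - {a}"
      show "u \<in> nbhd E a"
      proof (cases "u = v")
        case True
        then show ?thesis using a by (simp add: nbhd_commute)
      next
        case False
        have "u \<notin> ?N" using a u by simp
        then obtain w where "w \<in> ?N" "u \<in> nbhd E w"
          using diam2[of v u] v u False by (auto simp: nbhd_def)
        then show ?thesis using a by simp
      qed
    qed
    moreover have "a \<in> V" using a nbhd_subset[of v] by auto
    ultimately show ?thesis using nodom[of a] nbhd_subset[of a] by blast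
  next
    case 3
    then obtain a b where "?N = {a, b}" "a \<noteq> b" by (auto simp: card_2_iff)
    then show ?thesis using card_edges_degree_two v nodom by blast
  next
    case 4
    have sub: "insert v ?N \<subseteq> V" "v \<notin> ?N"
      using v nbhd_subset[of v] by auto
    then have c: "card (insert v ?N) = 4" using 4 by simp
    have "3 * card (V - insert v ?N) = (\<Sum>u\<in>V - insert v ?N. 3)"
      by simp
    also have "\<dots> \<le> (\<Sum>u\<in>V - insert v ?N. card (nbhd E u))"
      using min 4 by (intro sum_mono) auto
    finally have "3 * card (V - insert v ?N) \<le> (\<Sum>u\<in>V - insert v ?N. card (nbhd E u))" .
    moreover have "(\<Sum>u\<in>V. card (nbhd E u)) = (\<Sum>u\<in>V - insert v ?N. card (nbhd E u))
        + (card ?N + (\<Sum>u\<in>?N. card (nbhd E u)))"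
      using sum.subset_diff[OF sub(1) finV, of "\<lambda>u. card (nbhd E u)"] sub(2) by simp
    moreover have "card (V - insert v ?N) = card V - 4" "4 \<le> card V"
      using c sub finV card_mono[OF finV sub(1)] by (auto simp: card_Diff_subset)
    \<comment> \<open>With \<open>n = card V\<close>, the degree sum is at least
      \<open>3 * (n - 4) + 3 + (n - 1) = 2 * (2 * n - 5)\<close>.\<close>
    ultimately show ?thesis
      using handshake sum_card_nbhd_nbhd[OF v] 4 by linarith
  next
    case 5
    have "card V * 4 \<le> (\<Sum>u\<in>V. card (nbhd E u))"
      using min 5 by (intro sum_bounded_below[where K = "4 :: nat", simplified]) (auto intro: order_trans)
    then show ?thesis using handshake by simp
  qed
qed

end

section \<open>Short paths, distances and diametral paths of length two\<close>

lemma is_path_vertex: "is_path G [u] \<longleftrightarrow> u \<in> verts G"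
  by (simp add: is_path_def)

lemma is_path_edge: "is_path G [u, v] \<longleftrightarrow> u \<noteq> v \<and> u \<in> verts G \<and> v \<in> verts G \<and> {u, v} \<in> edges G"
  by (auto simp: is_path_def less_Suc_eq)

lemma is_path_two_edges: "is_path G [u, w, v] \<longleftrightarrow>
    distinct [u, w, v] \<and> {u, w, v} \<subseteq> verts G \<and> {u, w} \<in> edges G \<and> {w, v} \<in> edges G"
  by (auto simp: is_path_def less_Suc_eq)

lemma distance_le:
  assumes "path_between G u v p"
  shows "distance G u v \<le> path_length p"
  unfolding distance_def using assms by (intro Least_le) blast

lemma shortest_path_exists:
  assumes "path_between G u v q"
  obtains p where "path_between G u v p" "path_length p = distance G u v"
proof -
  have "\<exists>n p. path_between G u v p \<and> path_length p = n"
    using assms by blast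
  then have "\<exists>p. path_between G u v p \<and> path_length p = distance G u v"
    unfolding distance_def by (rule LeastI_ex)
  then show ?thesis using that by blast
qed

lemma list_path_length_le_2:
  assumes "p \<noteq> []" "path_length p \<le> 2"
  obtains x where "p = [x]" | x y where "p = [x, y]" | x y z where "p = [x, y, z]"
  using assms by (cases p rule: remdups_adj.cases; cases "tl (tl p)"; cases "tl (tl (tl p))")
    (auto simp: path_length_def)

text \<open>The bridge between the path-based \<open>distance\<close> and the edge conditions used
  in \<open>graph_diam2\<close>: a shortest path with at most two edges has at most three
  vertices.\<close>

lemma distance_le_2_iff:
  assumes G: "finite_simple_connected G" and uv: "u \<in> verts G" "v \<in> verts G"
  shows "distance G u v \<le> 2 \<longleftrightarrow>
    u = v \<or> {u, v} \<in> edges G \<or> (\<exists>w. {u, w} \<in> edges G \<and> {w, v} \<in> edges G)"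
proof
  assume d: "distance G u v \<le> 2"
  obtain p where p: "path_between G u v p" "path_length p = distance G u v"
    using G uv shortest_path_exists unfolding finite_simple_connected_def by metis
  then have "p \<noteq> []" by (auto simp: path_between_def is_path_def)
  then show "u = v \<or> {u, v} \<in> edges G \<or> (\<exists>w. {u, w} \<in> edges G \<and> {w, v} \<in> edges G)"
    by (rule list_path_length_le_2[of p])
      (use d p in \<open>auto simp: path_between_def is_path_edge is_path_two_edges\<close>)
next
  assume r: "u = v \<or> {u, v} \<in> edges G \<or> (\<exists>w. {u, w} \<in> edges G \<and> {w, v} \<in> edges G)"
  have E: "x \<noteq> y \<and> x \<in> verts G \<and> y \<in> verts G" if "{x, y} \<in> edges G" for x y
    using G that by (cases "x = y") (auto simp: finite_simple_connected_def)
  consider "u = v" | "u \<noteq> v" "{u, v} \<in> edges G"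
    | w where "u \<noteq> v" "{u, w} \<in> edges G" "{w, v} \<in> edges G"
    using r by blast
  then show "distance G u v \<le> 2"
  proof cases
    case 1
    then show ?thesis using distance_le[of G u v "[u]"] uv
      by (auto simp: path_between_def is_path_vertex path_length_def)
  next
    case 2
    then show ?thesis using distance_le[of G u v "[u, v]"] uv
      by (auto simp: path_between_def is_path_edge path_length_def)
  next
    case 3
    then show ?thesis using distance_le[of G u v "[u, w, v]"] uv E[of u w] E[of w v]
      by (auto simp: path_between_def is_path_two_edges path_length_def)
  qed
qed

lemma distance_le_diameter:
  assumes "finite_simple_connected G" "u \<in> verts G" "v \<in> verts G"
  shows "distance G u v \<le> diameter G"
proof -
  have "{distance G u v | u v. u \<in> verts G \<and> v \<in> verts G} =
      (\<lambda>(u, v). distance G u v) ` (verts G \<times> verts G)"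
    by auto
  then have "finite {distance G u v | u v. u \<in> verts G \<and> v \<in> verts G}"
    using assms(1) by (simp add: finite_simple_connected_def)
  then show ?thesis
    unfolding diameter_def using assms by (intro Max_ge) auto
qed

lemma diametral_path_2D:
  assumes p: "diametral_path G p" "path_length p = 2"
  obtains x y z where "p = [x, y, z]" "distinct [x, y, z]" "{x, y, z} \<subseteq> verts G"
    "{x, y} \<in> edges G" "{y, z} \<in> edges G" "diameter G = 2"
proof -
  have "p \<noteq> []" using p by (auto simp: path_length_def)
  then show ?thesis
    by (rule list_path_length_le_2[of p])
      (use p that in \<open>auto simp: path_length_def diametral_path_def shortest_path_def is_path_two_edges\<close>)
qed

text \<open>The ends are distinct and not adjacent, which excludes distances 0 and 1; the uniform
  bound 2 then fixes both their distance and the diameter.\<close>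

lemma diametral_path_2I:
  assumes G: "finite_simple_connected G"
    and p: "is_path G [x, y, z]" "{x, z} \<notin> edges G"
    and diam: "\<And>u v. u \<in> verts G \<Longrightarrow> v \<in> verts G \<Longrightarrow> distance G u v \<le> 2"
  shows "diametral_path G [x, y, z]"
proof -
  have xz: "x \<in> verts G" "z \<in> verts G" "x \<noteq> z"
    using p by (auto simp: is_path_two_edges)
  obtain q where q: "path_between G x z q" "path_length q = distance G x z"
    using G xz shortest_path_exists unfolding finite_simple_connected_def by metis
  then have "q \<noteq> []" by (auto simp: path_between_def is_path_def)
  then have d: "distance G x z = 2"
    by (rule list_path_length_le_2[of q])
      (use q diam[OF xz(1,2)] xz(3) p(2) in \<open>auto simp: path_between_def is_path_edge path_length_def\<close>)
  have "diameter G \<le> 2"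
    unfolding diameter_def
  proof (rule Max.boundedI)
    have "{distance G u v | u v. u \<in> verts G \<and> v \<in> verts G} \<subseteq> {..2}"
      using diam by auto
    then show "finite {distance G u v | u v. u \<in> verts G \<and> v \<in> verts G}"
      by (rule finite_subset) simp
  qed (use xz diam in auto)
  then have "diameter G = 2"
    using distance_le_diameter[OF G xz(1,2)] d by simp
  then show ?thesis
    using p d by (simp add: diametral_path_def shortest_path_def path_length_def)
qed

section \<open>The lower bound for the number of edges\<close>

lemma card_edges_ge:
  assumes G: "finite_simple_connected G" and P: "has_disjoint_diametral_paths k 2 G" and k: "k \<ge> 1"
  shows "5 * k - 3 \<le> card (edges G)"
proof -
  obtain P where P: "finite P" "card P = k" and disj: "totally_disjoint P"
    and diam: "\<And>p. p \<in> P \<Longrightarrow> diametral_path G p \<and> path_length p = 2"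
    using P by (auto simp: has_disjoint_diametral_paths_def)
  have "P \<noteq> {}" using P k by auto
  then have D: "diameter G = 2"
    using diam diametral_path_2D by blast
  interpret graph_diam2 "verts G" "edges G"
  proof
    fix u v assume "u \<in> verts G" "v \<in> verts G" "u \<noteq> v" "{u, v} \<notin> edges G"
    then show "\<exists>w. {u, w} \<in> edges G \<and> {w, v} \<in> edges G"
      using distance_le_2_iff[OF G] distance_le_diameter[OF G] D by metis
  qed (use G in \<open>auto simp: finite_simple_connected_def\<close>)
  have sets: "set p \<subseteq> verts G \<and> card (set p) = 3" if "p \<in> P" for p
    using diam[OF that] diametral_path_2D[of G p "set p \<subseteq> verts G \<and> card (set p) = 3"] by auto
  have dj: "set p \<inter> set q = {}" if "p \<in> P" "q \<in> P" "p \<noteq> q" for p q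
    using disj that by (auto simp: totally_disjoint_def)
  have "card (\<Union>p\<in>P. set p) = (\<Sum>p\<in>P. card (set p))"
    using P dj by (intro card_UN_disjoint) auto
  then have "3 * k = card (\<Union>p\<in>P. set p)"
    using sets P by simp
  also have "\<dots> \<le> card (verts G)"
    using finV sets by (intro card_mono) auto
  finally have n: "3 * k \<le> card (verts G)" .
  \<comment> \<open>Stated for subsets of \<open>P\<close> because it is applied both to all paths
    and to those avoiding a dominating vertex.\<close>
  have path_edges: "2 * card Q \<le> card {e \<in> edges G. e \<subseteq> (\<Union>p\<in>Q. set p)}" if "Q \<subseteq> P" for Q
  proof -
    define F where "F p = {e \<in> edges G. e \<subseteq> set p}" for p :: "'a list"
    have finQ: "finite Q" using that P finite_subset by blast
    have two: "2 \<le> card (F p)" if "p \<in> P" for p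
    proof -
      obtain x y z where p: "p = [x, y, z]" "distinct [x, y, z]"
        "{x, y} \<in> edges G" "{y, z} \<in> edges G"
        using diam[OF \<open>p \<in> P\<close>] diametral_path_2D[of G p thesis] by auto
      have "card {{x, y}, {y, z}} \<le> card (F p)"
        using finE p by (intro card_mono) (auto simp: F_def)
      moreover have "card {{x, y}, {y, z}} = 2"
        using p(2) by (auto simp: card_2_iff doubleton_eq_iff)
      ultimately show ?thesis by simp
    qed
    have "F p \<inter> F q = {}" if "p \<in> P" "q \<in> P" "p \<noteq> q" for p q
    proof -
      \<comment> \<open>A common edge would lie in two disjoint vertex sets, but edges are
        nonempty.\<close>
      have "e = {}" if "e \<in> F p" "e \<in> F q" for e
        using that dj[OF \<open>p \<in> P\<close> \<open>q \<in> P\<close> \<open>p \<noteq> q\<close>] by (auto simp: F_def)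
      moreover have "{} \<notin> F p"
        using edge[of "{}"] by (auto simp: F_def)
      ultimately show ?thesis by blast
    qed
    then have "card (\<Union>p\<in>Q. F p) = (\<Sum>p\<in>Q. card (F p))"
      using finQ finE that by (intro card_UN_disjoint) (auto simp: F_def)
    moreover have "card Q * 2 \<le> (\<Sum>p\<in>Q. card (F p))"
      using two that sum_bounded_below[of Q 2 "\<lambda>p. card (F p)"] by auto
    moreover have "card (\<Union>p\<in>Q. F p) \<le> card {e \<in> edges G. e \<subseteq> (\<Union>p\<in>Q. set p)}"
      using finE by (intro card_mono) (auto simp: F_def)
    ultimately show ?thesis by linarith
  qed
  show ?thesis
  proof (cases "\<exists>v\<in>verts G. nbhd (edges G) v = verts G - {v}")
    case True
    then obtain v where v: "v \<in> verts G" "nbhd (edges G) v = verts G - {v}" by blast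
    define Q where "Q = {p \<in> P. v \<notin> set p}"
    \<comment> \<open>Disjoint paths cannot both contain \<open>v\<close>.\<close>
    have "card (P - Q) \<le> 1"
    proof -
      have "p = q" if "p \<in> P - Q" "q \<in> P - Q" for p q
        using dj[of p q] that by (auto simp: Q_def)
      then show ?thesis
        using P by (auto simp: card_le_Suc0_iff_eq)
    qed
    moreover have "card (P - Q) = k - card Q" "card Q \<le> k"
      using P by (auto simp: Q_def card_Diff_subset intro: card_mono)
    ultimately have Q: "k \<le> card Q + 1" by linarith
    have "card {e \<in> edges G. v \<in> e} = card (verts G) - 1"
      using v finV card_nbhd[of v] by simp
    moreover have "2 * card Q \<le> card {e \<in> edges G. v \<notin> e}"
    proof -
      have "card {e \<in> edges G. e \<subseteq> (\<Union>p\<in>Q. set p)} \<le> card {e \<in> edges G. v \<notin> e}"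
        using finE by (intro card_mono) (auto simp: Q_def)
      then show ?thesis
        using path_edges[of Q] by (auto simp: Q_def)
    qed
    moreover have "card (edges G) = card {e \<in> edges G. v \<in> e} + card {e \<in> edges G. v \<notin> e}"
    proof -
      have "edges G = {e \<in> edges G. v \<in> e} \<union> {e \<in> edges G. v \<notin> e}"
        by blast
      also have "card \<dots> = card {e \<in> edges G. v \<in> e} + card {e \<in> edges G. v \<notin> e}"
        using finE by (intro card_Un_disjoint) auto
      finally show ?thesis .
    qed
    \<comment> \<open>The count is \<open>(3 * k - 1) + 2 * (k - 1) = 5 * k - 3\<close>.\<close>
    ultimately show ?thesis
      using n Q k by linarith
  next
    case False
    then have "2 * card (verts G) \<le> card (edges G) + 5"
      using card_edges_no_dominating n k by auto
    \<comment> \<open>This settles \<open>k = 1\<close>, where \<open>2 * (3 * k) - 5\<close> is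
      only 1; for larger \<open>k\<close> that expression is already at least
      \<open>5 * k - 3\<close>.\<close>
    moreover have "2 * k \<le> card (edges G)"
      using path_edges[of P] P card_mono[OF finE, of "{e \<in> edges G. e \<subseteq> (\<Union>p\<in>P. set p)}"] by auto
    ultimately show ?thesis
      using n k by linarith
  qed
qed

text \<open>The graph \<open>G\<close> guarantees that the \<open>LEAST\<close> in
  \<open>MinE\<close> is attained: an injection of its vertices into the naturals copies it to a
  \<open>nat graph\<close>.\<close>

lemma MinE_ge:
  fixes G :: "'v graph"
  assumes G: "finite_simple_connected G" "has_disjoint_diametral_paths k d G"
    and le: "\<And>H :: nat graph. finite_simple_connected H \<Longrightarrow> has_disjoint_diametral_paths k d H \<Longrightarrow>
      m \<le> card (edges H)"
  shows "m \<le> MinE k d"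
proof -
  obtain f :: "'v \<Rightarrow> nat" where inj: "inj_on f (verts G)"
    using G finite_imp_inj_to_nat_seg by (metis finite_simple_connected_def)
  have "\<forall>e \<in> edges G. e \<subseteq> verts G"
    using G by (simp add: finite_simple_connected_def)
  then have "\<exists>m. \<exists>H :: nat graph. finite_simple_connected H \<and>
      has_disjoint_diametral_paths k d H \<and> card (edges H) = m"
    using finite_simple_connected_image_graph[OF inj G(1)]
      has_disjoint_diametral_paths_image_graph[OF inj _ G(2)] by blast
  then have "\<exists>H :: nat graph. finite_simple_connected H \<and>
      has_disjoint_diametral_paths k d H \<and> card (edges H) = MinE k d"
    unfolding MinE_def by (rule LeastI_ex)
  then show ?thesis
    using le by metis
qed

section \<open>The graph \<open>DDPG2\<close> attains the bound\<close>

lemma DDPG2_path_edge: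
  assumes "1 \<le> i" "i \<le> k" "j < 2"
  shows "{(i, j), (i, Suc j)} \<in> edges (DDPG2 k)"
proof -
  have "{(i, j), (i, Suc j)} \<in> {{(i, j), (i, Suc j)} | i j. i \<in> {1..k} \<and> j < 2}"
    using assms by (intro CollectI exI[of _ i] exI[of _ j]) simp
  then show ?thesis
    by (simp add: DDPG2_def)
qed

text \<open>The vertex \<open>(1, 1)\<close> dominates: path edges reach the ends of its own path,
  the added edges everything else. Hence any two vertices are at distance at most 2.\<close>

lemma DDPG2_hub:
  assumes "u \<in> verts (DDPG2 k)" "u \<noteq> (1, 1)"
  shows "{u, (1, 1)} \<in> edges (DDPG2 k)"
proof -
  obtain i j where u: "u = (i, j)" by fastforce
  have ij: "1 \<le> i" "i \<le> k" "j \<le> 2" using assms u by (auto simp: DDPG2_def)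
  show ?thesis
  proof (cases "i = 1")
    case True
    then have "j = 0 \<or> j = 2" using assms u ij by auto
    then show ?thesis
    proof
      assume "j = 0"
      then have "{u, (1, 1)} = {(i, 0), (i, Suc 0)}" using u True by auto
      then show ?thesis using DDPG2_path_edge[of i k 0] ij by simp
    next
      assume "j = 2"
      then have "{u, (1, 1)} = {(i, 1), (i, Suc 1)}" using u True by auto
      then show ?thesis using DDPG2_path_edge[of i k 1] ij by simp
    qed
  next
    case False
    then have "{u, (1, 1)} = {(1, 1), (i, j)}" "1 < i" using u ij by auto
    moreover have "{(1, 1), (i, j)} \<in> {{(1, 1), (i, j)} | i j. 1 < i \<and> i \<le> k \<and> j \<le> 2}"
      using ij \<open>1 < i\<close> by (intro CollectI exI[of _ i] exI[of _ j]) simp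
    ultimately show ?thesis by (simp add: DDPG2_def)
  qed
qed

lemma DDPG2_edge:
  assumes "k \<ge> 1" "e \<in> edges (DDPG2 k)"
  shows "e \<subseteq> verts (DDPG2 k) \<and> card e = 2"
  using assms by (auto simp: DDPG2_def)

lemma finite_simple_connected_DDPG2:
  assumes "k \<ge> 1"
  shows "finite_simple_connected (DDPG2 k)"
proof -
  have hub: "(1, 1) \<in> verts (DDPG2 k)" using assms by (simp add: DDPG2_def)
  have "\<exists>p. path_between (DDPG2 k) u v p" if uv: "u \<in> verts (DDPG2 k)" "v \<in> verts (DDPG2 k)" for u v
  proof -
    consider "u = v" | "u \<noteq> v" "u = (1, 1)" | "u \<noteq> v" "v = (1, 1)"
      | "u \<noteq> v" "u \<noteq> (1, 1)" "v \<noteq> (1, 1)" by blast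
    then show ?thesis
    proof cases
      case 1
      then have "path_between (DDPG2 k) u v [u]" using uv by (simp add: path_between_def is_path_vertex)
      then show ?thesis ..
    next
      case 2
      then have "path_between (DDPG2 k) u v [u, v]"
        using uv DDPG2_hub[OF uv(2)] by (auto simp: path_between_def is_path_edge insert_commute)
      then show ?thesis ..
    next
      case 3
      then have "path_between (DDPG2 k) u v [u, v]"
        using uv DDPG2_hub[OF uv(1)] by (auto simp: path_between_def is_path_edge)
      then show ?thesis ..
    next
      case 4
      then have "path_between (DDPG2 k) u v [u, (1, 1), v]"
        using uv hub DDPG2_hub[OF uv(1)] DDPG2_hub[OF uv(2)]
        by (auto simp: path_between_def is_path_two_edges insert_commute)
      then show ?thesis ..
    qed
  qed
  moreover have "finite (verts (DDPG2 k))" by (simp add: DDPG2_def)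
  ultimately show ?thesis
    using hub DDPG2_edge[OF assms] unfolding finite_simple_connected_def by blast
qed

lemma has_disjoint_diametral_paths_DDPG2:
  assumes k: "k \<ge> 1"
  shows "has_disjoint_diametral_paths k 2 (DDPG2 k)"
proof -
  define f :: "nat \<Rightarrow> (nat \<times> nat) list" where "f i = [(i, 0), (i, 1), (i, 2)]" for i
  note G = finite_simple_connected_DDPG2[OF k]
  have dist: "distance (DDPG2 k) u v \<le> 2" if uv: "u \<in> verts (DDPG2 k)" "v \<in> verts (DDPG2 k)" for u v
    using distance_le_2_iff[OF G uv] DDPG2_hub[OF uv(1)] DDPG2_hub[OF uv(2)]
    by (cases "u = (1, 1)"; cases "v = (1, 1)") (auto simp: insert_commute)
  have "diametral_path (DDPG2 k) (f i)" if i: "i \<in> {1..k}" for i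
    unfolding f_def
  proof (rule diametral_path_2I[OF G _ _ dist])
    have "{(i, 0), (i, Suc 0)} \<in> edges (DDPG2 k)" "{(i, 1), (i, Suc 1)} \<in> edges (DDPG2 k)"
      using DDPG2_path_edge[of i k 0] DDPG2_path_edge[of i k 1] i by auto
    then show "is_path (DDPG2 k) [(i, 0), (i, 1), (i, 2)]"
      using i by (auto simp: is_path_two_edges DDPG2_def numeral_2_eq_2)
    \<comment> \<open>Path edges join consecutive second coordinates, and every added edge contains
      \<open>(1, 1)\<close>, which is not an end of a path.\<close>
    show "{(i, 0), (i, 2)} \<notin> edges (DDPG2 k)"
      by (auto simp: DDPG2_def doubleton_eq_iff)
  qed
  moreover have "card (f ` {1..k}) = k"
    by (subst card_image) (auto simp: f_def inj_on_def)
  moreover have "totally_disjoint (f ` {1..k})"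
    by (auto simp: totally_disjoint_def f_def)
  ultimately show ?thesis
    unfolding has_disjoint_diametral_paths_def
    by (intro exI[of _ "f ` {1..k}"]) (auto simp: f_def path_length_def)
qed

text \<open>There are at most \<open>2 * k\<close> path edges and \<open>3 * (k - 1)\<close> edges
  at the hub. The reverse inequality comes from the general lower bound.\<close>

lemma card_edges_DDPG2_le:
  assumes "k \<ge> 1"
  shows "card (edges (DDPG2 k)) \<le> 5 * k - 3"
proof -
  define A where "A = (\<lambda>(i, j). {(i, j), (i, Suc j)}) ` ({1..k} \<times> {..<2})"
  define B where "B = (\<lambda>x. {(1, 1), x}) ` ({2..k} \<times> {..2 :: nat})"
  have "edges (DDPG2 k) \<subseteq> A \<union> B"
  proof
    fix e assume "e \<in> edges (DDPG2 k)"
    then consider i j where "e = {(i, j), (i, Suc j)}" "i \<in> {1..k}" "j < 2"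
      | i j where "e = {(1, 1), (i, j)}" "1 < i" "i \<le> k" "j \<le> 2"
      unfolding DDPG2_def graph.simps Un_iff mem_Collect_eq by blast
    then show "e \<in> A \<union> B"
    proof cases
      case 1
      then have "e \<in> A"
        unfolding A_def by (intro image_eqI[of _ _ "(i, j)"]) auto
      then show ?thesis ..
    next
      case 2
      then have "e \<in> B"
        unfolding B_def by (intro image_eqI[of _ _ "(i, j)"]) auto
      then show ?thesis ..
    qed
  qed
  then have "card (edges (DDPG2 k)) \<le> card (A \<union> B)"
    by (intro card_mono) (auto simp: A_def B_def)
  moreover have "card A \<le> 2 * k" "card B \<le> 3 * (k - 1)"
    unfolding A_def B_def by (rule order_trans[OF card_image_le]; simp)+
  moreover have "card (A \<union> B) \<le> card A + card B"
    by (rule card_Un_le)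
  ultimately show ?thesis
    using assms by simp
qed

theorem theorem12:
  fixes k :: nat
  assumes "k \<ge> 1"
  shows "extremal k 2 (DDPG2 k)"
proof -
  note G = finite_simple_connected_DDPG2[OF assms]
  note P = has_disjoint_diametral_paths_DDPG2[OF assms]
  have "5 * k - 3 \<le> MinE k 2"
    using MinE_ge[OF G P] card_edges_ge assms by blast
  \<comment> \<open>The chain from \<open>5 * k - 3\<close> through \<open>MinE k 2\<close> and the
    edge count of \<open>DDPG2 k\<close> back to \<open>5 * k - 3\<close> collapses.\<close>
  then have "card (edges (DDPG2 k)) = MinE k 2"
    using MinE_le[OF G P] card_edges_DDPG2_le[OF assms] by linarith
  then show ?thesis
    using G P by (simp add: extremal_def)
qed

end
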